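(* Grigorchuk's group is a homomorphic image of a nonprincipal ultraproduct of groups if and only if there exists a measurable cardinal.
   Context: Grigorchuk's group is the subgroup of the automorphism group of the infinite rooted binary tree $\{0,1\}^*$ (finite binary sequences ordered by the prefix relation) generated by the automorphisms $a,b,c,d$ defined recursively, for every $w \in \{0,1\}^*$ (each fixing the empty sequence), by: $a(0w) = 1w$, $a(1w) = 0w$; $b(0w) = 0a(w)$, $b(1w) = 1c(w)$; $c(0w) = 0a(w)$, $c(1w) = 1d(w)$; $d(0w) = 0w$, $d(1w) = 1b(w)$. An ultrafilter $\mathcal{U}$ on a set $X$ is a collection of subsets of $X$ such that $\emptyset \notin \mathcal{U}$; for each $Y \subseteq X$ either $Y \in \mathcal{U}$ or $X \setminus Y \in \mathcal{U}$; and $X_0, X_1 \in \mathcal{U}$ implies $X_0 \cap X_1 \in \mathcal{U}$. It is nonprincipal if $\{x\} \notin \mathcal{U}$ for each $x \in X$. If $\mathcal{U}$ is an ultrafilter on a set $I$ and $\{G_i\}_{i \in I}$ is a collection of groups, the ultraproduct $\prod_{i \in I} G_i/\mathcal{U}$ is the quotient of $\prod_{i \in I} G_i$ by the normal subgroup $\{(g_i)_{i \in I} \mid \{i \in I \mid g_i = 1\} \in \mathcal{U}\}$; it is called a nonprincipal ultraproduct when $\mathcal{U}$ is nonprincipal. Here the index set $I$ is arbitrary. "Homomorphic image" means image under a surjective homomorphism. An ultrafilter $\mathcal{U}$ is $\kappa$-complete if whenever $\mathcal{J} \subseteq \mathcal{U}$ has $|\mathcal{J}| < \kappa$ we have $\bigcap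 \mathcal{J} \in \mathcal{U}$. A cardinal $\kappa > \aleph_0$ is measurable if there exists a nonprincipal $\kappa$-complete ultrafilter on a set $X$ with $|X| = \kappa$. *)

theory Defs
  imports "HOL-Algebra.Algebra" "HOL-Library.Sublist"
begin

unbundle cardinal_syntax

text \<open>The vertices of the infinite rooted binary tree are the values of type \<^typ>\<open>bool list\<close>,
  with \<^const>\<open>False\<close> for the letter 0 and \<^const>\<open>True\<close> for the letter 1.\<close>

fun grig_a :: "bool list \<Rightarrow> bool list" where
  "grig_a [] = []"
| "grig_a (False # w) = True # w"
| "grig_a (True # w) = False # w"

fun grig_b :: "bool list \<Rightarrow> bool list"
  and grig_c :: "bool list \<Rightarrow> bool list"
  and grig_d :: "bool list \<Rightarrow> bool list" where
  "grig_b [] = []"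
| "grig_b (False # w) = False # grig_a w"
| "grig_b (True # w) = True # grig_c w"
| "grig_c [] = []"
| "grig_c (False # w) = False # grig_a w"
| "grig_c (True # w) = True # grig_d w"
| "grig_d [] = []"
| "grig_d (False # w) = False # w"
| "grig_d (True # w) = True # grig_b w"

definition tree_aut_group :: "(bool list \<Rightarrow> bool list) monoid" where
  "tree_aut_group =
    \<lparr>carrier = {f. bij f \<and> (\<forall>u v. prefix (f u) (f v) \<longleftrightarrow> prefix u v)},
     monoid.mult = (\<circ>), one = id\<rparr>"

lemma group_tree_aut_group: "group tree_aut_group"
proof (rule groupI)
  fix f assume f: "f \<in> carrier tree_aut_group"
  then have b: "bij f" and p: "\<And>u v. prefix (f u) (f v) \<longleftrightarrow> prefix u v"
    by (auto simp: tree_aut_group_def)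
  have "prefix (inv_into UNIV f u) (inv_into UNIV f v) \<longleftrightarrow> prefix u v" for u v
    using p[of "inv_into UNIV f u" "inv_into UNIV f v"] b by (simp add: bij_is_surj surj_f_inv_f)
  then have "inv_into UNIV f \<in> carrier tree_aut_group"
    using b by (simp add: tree_aut_group_def bij_imp_bij_inv)
  moreover have "inv_into UNIV f \<circ> f = id"
    using b by (simp add: bij_is_inj)
  ultimately show "\<exists>g\<in>carrier tree_aut_group. g \<otimes>\<^bsub>tree_aut_group\<^esub> f = \<one>\<^bsub>tree_aut_group\<^esub>"
    by (auto simp: tree_aut_group_def)
qed (auto simp: tree_aut_group_def bij_comp)

lemma grig_a_involution: "grig_a (grig_a w) = w"
  by (cases w rule: grig_a.cases) auto

lemma grig_bcd_involution:
  "grig_b (grig_b w) = w" "grig_c (grig_c w) = w" "grig_d (grig_d w) = w"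
  by (induction w and w and w rule: grig_b_grig_c_grig_d.induct) (auto simp: grig_a_involution)

lemma grig_a_prefix: "prefix u v \<Longrightarrow> prefix (grig_a u) (grig_a v)"
  by (cases u rule: grig_a.cases; cases v rule: grig_a.cases) auto

lemma prefix_ConsE:
  assumes "prefix (x # u) v"
  obtains w where "v = x # w" "prefix u w"
  using assms by (cases v) auto

lemma grig_bcd_prefix:
  "\<forall>v. prefix u v \<longrightarrow> prefix (grig_b u) (grig_b v)"
  "\<forall>v. prefix u v \<longrightarrow> prefix (grig_c u) (grig_c v)"
  "\<forall>v. prefix u v \<longrightarrow> prefix (grig_d u) (grig_d v)"
  by (induction u and u and u rule: grig_b_grig_c_grig_d.induct)
    (auto simp: grig_a_prefix elim!: prefix_ConsE)

lemma prefix_involution_in_tree_aut_group: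
  assumes "\<And>w. f (f w) = w" "\<And>u v. prefix u v \<Longrightarrow> prefix (f u) (f v)"
  shows "f \<in> carrier tree_aut_group"
proof -
  have "bij f"
    using assms(1) by (intro o_bij[of f f]) auto
  moreover have "prefix (f u) (f v) \<longleftrightarrow> prefix u v" for u v
    using assms(2)[of u v] assms(2)[of "f u" "f v"] assms(1) by auto
  ultimately show ?thesis
    by (simp add: tree_aut_group_def)
qed

lemma grig_generators_in_tree_aut_group: "{grig_a, grig_b, grig_c, grig_d} \<subseteq> carrier tree_aut_group"
  using grig_a_involution grig_bcd_involution grig_a_prefix grig_bcd_prefix
  by (auto intro!: prefix_involution_in_tree_aut_group)

definition grigorchuk_group :: "(bool list \<Rightarrow> bool list) monoid" where
  "grigorchuk_group = subgroup_generated tree_aut_group {grig_a, grig_b, grig_c, grig_d}"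

definition ultrafilter_on :: "'i set \<Rightarrow> 'i set set \<Rightarrow> bool" where
  "ultrafilter_on S U \<longleftrightarrow>
     U \<subseteq> Pow S \<and> {} \<notin> U \<and>
     (\<forall>Y. Y \<subseteq> S \<longrightarrow> Y \<in> U \<or> S - Y \<in> U) \<and>
     (\<forall>Y\<in>U. \<forall>Z\<in>U. Y \<inter> Z \<in> U)"

definition nonprincipal_on :: "'i set \<Rightarrow> 'i set set \<Rightarrow> bool" where
  "nonprincipal_on S U \<longleftrightarrow> (\<forall>x\<in>S. {x} \<notin> U)"

text \<open>The factors of a family share one element type \<open>'g\<close>, but each has its own carrier. Any set-indexed
  family of groups can be moved into a common type; when \<open>'g\<close> is finite there is too little room for
  infinite groups, so existence statements about such families need \<open>'g\<close> to be infinite.\<close>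

definition ultraproduct ::
    "'i set \<Rightarrow> ('i \<Rightarrow> 'g monoid) \<Rightarrow> 'i set set \<Rightarrow> ('i \<Rightarrow> 'g) set monoid" where
  "ultraproduct I G U =
     product_group I G Mod
       {x \<in> carrier (product_group I G). {i \<in> I. x i = \<one>\<^bsub>G i\<^esub>} \<in> U}"

text \<open>Cardinals are the cardinal orders of HOL's cardinal theory. Intersecting with the underlying
  set \<open>S\<close> makes the empty family contribute \<open>S\<close> instead of \<^term>\<open>UNIV\<close>.\<close>

definition complete_on :: "'k rel \<Rightarrow> 'i set \<Rightarrow> 'i set set \<Rightarrow> bool" where
  "complete_on \<kappa> S U \<longleftrightarrow> (\<forall>J. J \<subseteq> U \<and> |J| <o \<kappa> \<longrightarrow> S \<inter> \<Inter>J \<in> U)"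

text \<open>A set of cardinality \<open>\<kappa>\<close> is in bijection with \<^term>\<open>Field \<kappa>\<close>, so it is no restriction
  that \<open>S\<close> has the element type of \<open>\<kappa>\<close>.\<close>

definition measurable_cardinal :: "'k rel \<Rightarrow> bool" where
  "measurable_cardinal \<kappa> \<longleftrightarrow>
     Card_order \<kappa> \<and> natLeq <o \<kappa> \<and>
     (\<exists>(S :: 'k set) U. |S| =o \<kappa> \<and> ultrafilter_on S U \<and> nonprincipal_on S U \<and> complete_on \<kappa> S U)"

end

theory Submission imports Defs begin

text \<open>The dividing line is countable completeness: a set carries a countably complete nonprincipal
  ultrafilter if and only if there is a measurable cardinal up to its size.

  If \<open>U\<close> is countably complete, then every map from the index set to a countable set is
  constant on a member of \<open>U\<close>. So the ultrapower of a countable group by \<open>U\<close> is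
  the group itself (\<open>countable_group_image_of_ultrapower\<close>), and a measurable cardinal supplies such a \<open>U\<close>.
  Conversely, a countably complete nonprincipal \<open>U\<close> gives a measurable cardinal: take the least
  \<open>\<kappa>\<close> such that \<open>U\<close> is not closed under some intersection of \<open>\<kappa>\<close> members, and push
  \<open>U\<close> forward to \<open>\<kappa>\<close> along a map that chooses for almost every point one of these \<open>\<kappa>\<close> members missing
  that point (\<open>countably_complete_imp_measurable_cardinal\<close>).

  If \<open>U\<close> is not countably complete, then the ultraproduct has the saturation property that every
  countable system of equations all of whose finite parts are solvable is solvable. If finite parts are solvable
  for all choices of the parameters, this passes to homomorphic images, because parameters can be lifted. The system used here is nested conjugation,
  \<open>y\<^sub>n = y\<^sub>n\<^sub>+\<^sub>1 p\<^sub>n y\<^sub>n\<^sub>+\<^sub>1\<inverse>\<close> for all natural numbers \<open>n\<close>,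
  with arbitrary parameters \<open>p\<^sub>n\<close>. Every finite part is solvable in every group by setting the last unknown to
  \<open>1\<close> and computing backwards, so every infinite system of this form is solvable in every homomorphic image of the
  ultraproduct (\<open>ultraproduct_nested_conjugation\<close>).

  In a countable weakly branch group of tree automorphisms the parameters can be chosen so that there is
  no solution (\<open>nested_conjugation_unsolvable\<close>), by diagonalisation. Put
  \<open>F\<^sub>0(x) = x\<close> and \<open>F\<^sub>n\<^sub>+\<^sub>1(x) = F\<^sub>n(x p\<^sub>n x\<inverse>)\<close>, so that any solution has
  \<open>y\<^sub>0 = F\<^sub>n(y\<^sub>n)\<close>. The parameters are taken in rigid stabilisers of vertices \<open>v\<^sub>0, v\<^sub>1, \<dots>\<close>, each
  one below the previous one and moved by the previous parameter. Moving \<open>v\<^sub>n\<^sub>+\<^sub>1\<close> makes \<open>F\<^sub>n\<^sub>+\<^sub>1\<close> injective on the rigid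
  stabiliser of \<open>v\<^sub>n\<^sub>+\<^sub>1\<close>, so the next parameter can be chosen such that \<open>F\<^sub>n\<^sub>+\<^sub>1\<close> does not
  send it to the next entry of an enumeration of the group. In a solution \<open>y\<^sub>n\<^sub>+\<^sub>1\<close> is trivial down to the level of
  \<open>v\<^sub>n\<^sub>+\<^sub>1\<close>, hence \<open>y\<^sub>0\<close> agrees with \<open>F\<^sub>n(p\<^sub>n)\<close> there; with \<open>v\<^sub>n\<^sub>+\<^sub>1\<close> deep enough,
  \<open>y\<^sub>0\<close> differs from the \<open>n\<close>-th element of the group, for every \<open>n\<close>.

  Grigorchuk's group is countable and weakly branch (\<open>weakly_branch_grigorchuk_group\<close>): the normal
  closure of \<open>(ab)\<^sup>2\<close> contains, with each \<open>k\<close>, the automorphisms acting as \<open>k\<close> on one of the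
  two subtrees of the root and trivially on the other.\<close>

section \<open>Automorphisms of the binary tree and rigid stabilisers\<close>

lemma tree_aut_bij: "f \<in> carrier tree_aut_group \<Longrightarrow> bij f"
  by (simp add: tree_aut_group_def)

lemma tree_aut_prefix_iff: "f \<in> carrier tree_aut_group \<Longrightarrow> prefix (f u) (f v) \<longleftrightarrow> prefix u v"
  by (simp add: tree_aut_group_def)

lemma prefixes_of_same_length:
  "prefix u w \<Longrightarrow> prefix v w \<Longrightarrow> length u = length v \<Longrightarrow> u = v"
  by (auto simp: prefix_def)

text \<open>The length of a word is determined by the order: a word has one prefix more than it has letters.\<close>

lemma tree_aut_length:
  assumes f: "f \<in> carrier tree_aut_group"
  shows "length (f w) = length w"
proof -
  have "f ` {u. prefix u w} = {u. prefix u (f w)}"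
    using tree_aut_prefix_iff[OF f] bij_is_surj[OF tree_aut_bij[OF f]] by (auto simp: image_iff) (metis surjD)
  moreover have "card (f ` {u. prefix u w}) = card {u. prefix u w}"
    using bij_is_inj[OF tree_aut_bij[OF f]] by (simp add: card_image inj_on_subset)
  moreover have "card {u. prefix u v} = Suc (length v)" for v :: "bool list"
    using distinct_card[OF distinct_prefixes, of v] by (simp add: set_prefixes_eq)
  ultimately show ?thesis by simp
qed

definition conj_by :: "('a \<Rightarrow> 'a) \<Rightarrow> ('a \<Rightarrow> 'a) \<Rightarrow> 'a \<Rightarrow> 'a" where
  "conj_by x p = x \<circ> p \<circ> inv_into UNIV x"

lemma conj_by_apply: "bij x \<Longrightarrow> conj_by x p (x w) = x (p w)"
  by (simp add: conj_by_def bij_is_inj)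

lemma conj_by_eqI:
  assumes "bij x" "y \<circ> x = x \<circ> p"
  shows "conj_by x p = y"
proof
  fix w
  obtain u where "w = x u" using assms(1) by (metis bij_pointE)
  with assms show "conj_by x p w = y w" by (simp add: conj_by_apply) (metis comp_apply)
qed

definition agree_to_level :: "nat \<Rightarrow> (bool list \<Rightarrow> bool list) \<Rightarrow> (bool list \<Rightarrow> bool list) \<Rightarrow> bool" where
  "agree_to_level l f g \<longleftrightarrow> (\<forall>w. length w \<le> l \<longrightarrow> f w = g w)"

text \<open>Fixing every vertex not strictly below \<open>v\<close> amounts, for an automorphism, to fixing every vertex
  outside the subtree at \<open>v\<close>. With the strict order the condition says at once that all levels down to
  that of \<open>v\<close> are fixed.\<close>

definition rigid_stabilizer :: "bool list \<Rightarrow> (bool list \<Rightarrow> bool list) set" where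
  "rigid_stabilizer v = {f. \<forall>w. \<not> strict_prefix v w \<longrightarrow> f w = w}"

lemma rigid_stabilizer_mono: "prefix u v \<Longrightarrow> rigid_stabilizer v \<subseteq> rigid_stabilizer u"
  unfolding rigid_stabilizer_def by (auto dest: prefix_order.le_less_trans)

lemma rigid_stabilizer_agree: "f \<in> rigid_stabilizer v \<Longrightarrow> agree_to_level (length v) f id"
  unfolding rigid_stabilizer_def agree_to_level_def
  using prefix_length_less by fastforce

text \<open>This is the condition on rigid stabilisers alone: transitivity on the levels, which is often included
  in the notion, is not part of it.\<close>

definition weakly_branch :: "(bool list \<Rightarrow> bool list) set \<Rightarrow> bool" where
  "weakly_branch H \<longleftrightarrow> (\<forall>v. \<exists>f \<in> H \<inter> rigid_stabilizer v. f \<noteq> id)"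

lemma conj_by_agree_arg:
  assumes "x \<in> carrier tree_aut_group" "agree_to_level l p q"
  shows "agree_to_level l (conj_by x p) (conj_by x q)"
  unfolding agree_to_level_def
proof safe
  fix w :: "bool list" assume w: "length w \<le> l"
  obtain u where u: "w = x u" using tree_aut_bij[OF assms(1)] by (metis bij_pointE)
  with w tree_aut_length[OF assms(1)] have "length u \<le> l" by simp
  with assms(2) show "conj_by x p w = conj_by x q w"
    by (simp add: u conj_by_apply[OF tree_aut_bij[OF assms(1)]] agree_to_level_def)
qed

text \<open>Since \<open>p\<close> preserves levels, the action of \<open>x p x\<inverse>\<close> on the first \<open>l\<close> levels is computed from the
  action of \<open>x\<close> and \<open>p\<close> there. So conjugation is continuous, uniformly in \<open>p\<close>.\<close>

lemma conj_by_agree: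
  assumes x: "x \<in> carrier tree_aut_group" and y: "y \<in> carrier tree_aut_group"
    and p: "p \<in> carrier tree_aut_group" and a: "agree_to_level l x y"
  shows "agree_to_level l (conj_by x p) (conj_by y p)"
  unfolding agree_to_level_def
proof safe
  fix w :: "bool list" assume w: "length w \<le> l"
  obtain u where u: "w = x u" using tree_aut_bij[OF x] by (metis bij_pointE)
  with w tree_aut_length[OF x] have l: "length u \<le> l" by simp
  then have "w = y u" "x (p u) = y (p u)"
    using a u tree_aut_length[OF p] by (auto simp: agree_to_level_def)
  then show "conj_by x p w = conj_by y p w"
    by (metis u conj_by_apply tree_aut_bij x y)
qed

lemma conj_by_rigid_stabilizer:
  assumes x: "x \<in> rigid_stabilizer v" "bij x" and p: "p \<in> rigid_stabilizer v"
  shows "conj_by x p \<in> rigid_stabilizer v"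
  unfolding rigid_stabilizer_def
proof safe
  fix w assume "\<not> strict_prefix v w"
  then show "conj_by x p w = w"
    using x p conj_by_apply[OF x(2), of p w] by (simp add: rigid_stabilizer_def)
qed

text \<open>As \<open>p\<close> moves \<open>v\<close> to another vertex of the same level, it takes the subtree at \<open>v\<close> off itself, to a
  place where \<open>x\<close> is trivial. Below \<open>v\<close> the conjugate \<open>x p x\<inverse>\<close> therefore acts as \<open>p x\<inverse>\<close>, from which \<open>x\<close> can be read off.\<close>

lemma conj_by_inj_on_rigid_stabilizer:
  assumes p: "p \<in> carrier tree_aut_group" and move: "p v \<noteq> v"
  shows "inj_on (\<lambda>x. conj_by x p) (rigid_stabilizer v \<inter> carrier tree_aut_group)"
proof (rule inj_onI)
  fix x y
  assume x: "x \<in> rigid_stabilizer v \<inter> carrier tree_aut_group"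
    and y: "y \<in> rigid_stabilizer v \<inter> carrier tree_aut_group"
    and eq: "conj_by x p = conj_by y p"
  note bx = tree_aut_bij[of x] and bb = tree_aut_bij[of y] and bp = tree_aut_bij[OF p]
  show "x = y"
  proof
    fix w
    show "x w = y w"
    proof (cases "strict_prefix v w")
      case False
      with x y show ?thesis by (simp add: rigid_stabilizer_def)
    next
      case True
      have "\<not> prefix v (p w)"
      proof
        assume "prefix v (p w)"
        moreover have "prefix (p v) (p w)"
          using True tree_aut_prefix_iff[OF p] by (simp add: strict_prefix_def)
        ultimately show False
          using move tree_aut_length[OF p, of v] by (auto dest: prefixes_of_same_length)
      qed
      then have np: "\<not> strict_prefix v (p w)" by (simp add: strict_prefix_def)
      have "\<not> strict_prefix v (p w) \<Longrightarrow> x (p w) = p w" "\<not> strict_prefix v (p w) \<Longrightarrow> y (p w) = p w"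
        using x y by (auto simp: rigid_stabilizer_def)
      with np have "x (p w) = p w" "y (p w) = p w" by auto
      moreover obtain u where u: "x w = y u" using bb y by (metis IntD2 bij_pointE)
      moreover have "conj_by x p (x w) = x (p w)" "conj_by y p (y u) = y (p u)"
        using bx bb x y by (auto simp: conj_by_apply)
      ultimately have "y (p w) = y (p u)" using eq by simp
      then have "w = u" using bb bp y by (metis IntD2 bij_is_inj injD)
      with u show ?thesis by simp
    qed
  qed
qed

lemma tree_aut_subgroup_conj_by:
  assumes "subgroup H tree_aut_group" "x \<in> H" "p \<in> H"
  shows "conj_by x p \<in> H"
proof -
  interpret subgroup H tree_aut_group by fact
  interpret group tree_aut_group by (rule group_tree_aut_group)
  let ?y = "x \<otimes>\<^bsub>tree_aut_group\<^esub> p \<otimes>\<^bsub>tree_aut_group\<^esub> inv\<^bsub>tree_aut_group\<^esub> x"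
  have y: "?y \<in> H" using assms by simp
  have "?y \<otimes>\<^bsub>tree_aut_group\<^esub> x = x \<otimes>\<^bsub>tree_aut_group\<^esub> p"
    using assms mem_carrier by (simp add: m_assoc)
  then have "conj_by x p = ?y"
    using assms mem_carrier by (intro conj_by_eqI tree_aut_bij) (simp_all add: tree_aut_group_def)
  with y show ?thesis by simp
qed

section \<open>Nested conjugation in weakly branch groups\<close>

text \<open>Nontrivial elements of the rigid stabilisers of the two children of \<open>v\<close> are distinct, so an
  injective map sends at most one of them to \<open>h\<close>.\<close>

lemma weakly_branch_avoid:
  assumes "weakly_branch H" and inj: "inj_on F (rigid_stabilizer v \<inter> H)"
  obtains p where "p \<in> rigid_stabilizer v \<inter> H" "p \<noteq> id" "F p \<noteq> h"
proof -
  from assms(1) obtain f g where f: "f \<in> H \<inter> rigid_stabilizer (v @ [False])" "f \<noteq> id"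
    and g: "g \<in> H \<inter> rigid_stabilizer (v @ [True])" "g \<noteq> id"
    unfolding weakly_branch_def by blast
  have "f \<noteq> g"
  proof
    assume "f = g"
    have "f w = w" for w
    proof (cases "strict_prefix (v @ [False]) w")
      case True
      then have "\<not> strict_prefix (v @ [True]) w"
        by (auto simp: strict_prefix_def prefix_def)
      with g \<open>f = g\<close> show ?thesis by (auto simp: rigid_stabilizer_def)
    qed (use f in \<open>auto simp: rigid_stabilizer_def\<close>)
    with f(2) show False by (auto simp: fun_eq_iff)
  qed
  moreover have fg: "f \<in> rigid_stabilizer v \<inter> H" "g \<in> rigid_stabilizer v \<inter> H"
    using f g rigid_stabilizer_mono[of v "v @ [False]"] rigid_stabilizer_mono[of v "v @ [True]"] by auto
  ultimately have "F f \<noteq> F g" using inj by (metis inj_onD)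
  then have "F f \<noteq> h \<or> F g \<noteq> h" by auto
  with f g fg that show ?thesis by blast
qed

text \<open>A moved vertex may be replaced by any vertex below it, so it can be taken at a level where two given
  distinct maps can be told apart.\<close>

lemma deep_moved_vertex:
  assumes p: "p \<in> rigid_stabilizer v" "p \<in> carrier tree_aut_group" "p \<noteq> id" and "f \<noteq> h"
  obtains v' where "prefix v v'" "p v' \<noteq> v'" "\<not> agree_to_level (length v') f h"
proof -
  from p(3) obtain w where w: "p w \<noteq> w" by (auto simp: fun_eq_iff)
  from \<open>f \<noteq> h\<close> obtain u where u: "f u \<noteq> h u" by (auto simp: fun_eq_iff)
  let ?v = "w @ replicate (length u) False"
  have "strict_prefix v w" using p(1) w by (auto simp: rigid_stabilizer_def)
  then have "prefix v ?v" by (auto simp: strict_prefix_def)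
  moreover have "p ?v \<noteq> ?v"
  proof
    assume "p ?v = ?v"
    moreover have "prefix (p w) (p ?v)" using tree_aut_prefix_iff[OF p(2)] by simp
    ultimately show False
      using w prefixes_of_same_length[of "p w" ?v w] tree_aut_length[OF p(2), of w] by simp
  qed
  moreover have "\<not> agree_to_level (length ?v) f h"
    using u unfolding agree_to_level_def by (auto intro!: exI[of _ u])
  ultimately show thesis by (rule that)
qed

text \<open>The diagonal argument. A state of the construction consists of the map \<open>F\<^sub>n\<close> sending \<open>y\<^sub>n\<close> to
  \<open>y\<^sub>0\<close>, the vertex \<open>v\<^sub>n\<close> and the parameter \<open>p\<^sub>n\<close>; besides injectivity, it has to be kept that \<open>F\<^sub>n\<close> does
  not decrease the level down to which two elements agree. The equations are written without inverses.\<close>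

lemma nested_conjugation_unsolvable:
  assumes sub: "subgroup H tree_aut_group" and "countable H" and wb: "weakly_branch H"
  obtains p where "\<And>n :: nat. p n \<in> H"
    and "\<And>y. (\<And>n :: nat. y n \<in> H) \<Longrightarrow> (\<And>n. y n \<circ> y (Suc n) = y (Suc n) \<circ> p n) \<Longrightarrow> False"
proof -
  interpret subgroup H tree_aut_group by fact
  have "H \<noteq> {}" using one_closed by blast
  then have enum: "range (from_nat_into H) = H"
    using \<open>countable H\<close> by (rule range_from_nat_into)
  define h where "h = from_nat_into H"
  define nonexpanding where "nonexpanding F \<longleftrightarrow> (\<forall>l. \<forall>x\<in>H. \<forall>y\<in>H. agree_to_level l x y \<longrightarrow> agree_to_level l (F x) (F y))"
    for F :: "(bool list \<Rightarrow> bool list) \<Rightarrow> (bool list \<Rightarrow> bool list)"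
  define P where "P n s = (case s of (F, v, p) \<Rightarrow>
      p \<in> rigid_stabilizer v \<inter> H \<and> p \<noteq> id \<and> F p \<noteq> h n \<and> inj_on F (rigid_stabilizer v \<inter> H) \<and> nonexpanding F)"
    for n and s :: "((bool list \<Rightarrow> bool list) \<Rightarrow> (bool list \<Rightarrow> bool list)) \<times> bool list \<times> (bool list \<Rightarrow> bool list)"
  define Q where "Q n s s' = (case s of (F, v, p) \<Rightarrow> case s' of (F', v', p') \<Rightarrow>
      F' = (\<lambda>x. F (conj_by x p)) \<and> \<not> agree_to_level (length v') (F p) (h n))"
    for n and s s' :: "((bool list \<Rightarrow> bool list) \<Rightarrow> (bool list \<Rightarrow> bool list)) \<times> bool list \<times> (bool list \<Rightarrow> bool list)"
  have "\<exists>s. (\<forall>n. P n (s n)) \<and> (\<forall>n. Q n (s n) (s (Suc n))) \<and> fst (s 0) = (\<lambda>x. x)"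
  proof -
    obtain p where "p \<in> rigid_stabilizer [] \<inter> H" "p \<noteq> id" "p \<noteq> h 0"
      using weakly_branch_avoid[OF wb, of "\<lambda>x. x" "[]" "h 0"] by auto
    then have "P 0 (\<lambda>x. x, [], p)" by (auto simp: P_def nonexpanding_def)
    then have 0: "\<exists>s. P 0 s \<and> (0 = (0::nat) \<longrightarrow> fst s = (\<lambda>x. x))" by fastforce
    have step: "\<exists>s'. (P (Suc n) s' \<and> (Suc n = 0 \<longrightarrow> fst s' = (\<lambda>x. x))) \<and> Q n s s'"
      if s: "P n s \<and> (n = 0 \<longrightarrow> fst s = (\<lambda>x. x))" for n s
    proof -
      obtain F v p where eq: "s = (F, v, p)" by (cases s)
      with s have p: "p \<in> rigid_stabilizer v" "p \<in> H" "p \<noteq> id" and Fp: "F p \<noteq> h n"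
        and inj: "inj_on F (rigid_stabilizer v \<inter> H)" and resp: "nonexpanding F"
        by (auto simp: P_def)
      obtain v' where v': "prefix v v'" "p v' \<noteq> v'" "\<not> agree_to_level (length v') (F p) (h n)"
        using deep_moved_vertex[OF p(1) mem_carrier[OF p(2)] p(3) Fp] by blast
      define F' where "F' = (\<lambda>x. F (conj_by x p))"
      have inj': "inj_on F' (rigid_stabilizer v' \<inter> H)"
      proof (rule inj_onI)
        fix x y assume x: "x \<in> rigid_stabilizer v' \<inter> H" and y: "y \<in> rigid_stabilizer v' \<inter> H" and "F' x = F' y"
        have "conj_by z p \<in> rigid_stabilizer v \<inter> H" if "z \<in> rigid_stabilizer v' \<inter> H" for z
          using that p rigid_stabilizer_mono[OF v'(1)] tree_aut_subgroup_conj_by[OF sub]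
          by (auto intro!: conj_by_rigid_stabilizer tree_aut_bij mem_carrier)
        with inj x y \<open>F' x = F' y\<close> have "conj_by x p = conj_by y p"
          unfolding F'_def by (metis inj_onD)
        then show "x = y"
          using inj_onD[OF conj_by_inj_on_rigid_stabilizer[where p = p and v = v']] p v' x y by auto
      qed
      obtain p' where p': "p' \<in> rigid_stabilizer v' \<inter> H" "p' \<noteq> id" "F' p' \<noteq> h (Suc n)"
        by (rule weakly_branch_avoid[OF wb inj'])
      have "nonexpanding F'"
        using resp unfolding nonexpanding_def F'_def
        by (auto intro!: conj_by_agree tree_aut_subgroup_conj_by[OF sub] mem_carrier p(2))
      with inj' p' have "P (Suc n) (F', v', p')" "Q n s (F', v', p')"
        using v' eq by (auto simp: P_def Q_def F'_def)
      then show ?thesis by blast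
    qed
    show ?thesis
      using dependent_nat_choice[of "\<lambda>n s. P n s \<and> (n = 0 \<longrightarrow> fst s = (\<lambda>x. x))" Q, OF 0 step] by blast
  qed
  then obtain s where s: "\<And>n. P n (s n)" "\<And>n. Q n (s n) (s (Suc n))" "fst (s 0) = (\<lambda>x. x)" by blast
  define F where "F n = fst (s n)" for n
  define v where "v n = fst (snd (s n))" for n
  define p where "p n = snd (snd (s n))" for n
  have p: "p n \<in> rigid_stabilizer (v n)" "p n \<in> H" and resp: "nonexpanding (F n)" for n
    using s(1)[of n] by (auto simp: P_def F_def v_def p_def split: prod.splits)
  have F0: "F 0 = (\<lambda>x. x)" using s(3) by (simp add: F_def)
  have F_Suc: "F (Suc n) x = F n (conj_by x (p n))"
    and deep: "\<not> agree_to_level (length (v (Suc n))) (F n (p n)) (h n)" for n x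
    using s(2)[of n] by (auto simp: Q_def F_def v_def p_def split: prod.splits)
  show thesis
  proof (rule that)
    show "p n \<in> H" for n by (rule p)
    fix y assume y: "\<And>n :: nat. y n \<in> H" and eq: "\<And>n. y n \<circ> y (Suc n) = y (Suc n) \<circ> p n"
    have conj: "conj_by (y (Suc n)) (p n) = y n" for n
      using eq y by (intro conj_by_eqI tree_aut_bij mem_carrier)
    \<comment> \<open>Unfolding the first \<open>n\<close> equations computes \<open>y 0\<close> from \<open>y n\<close>.\<close>
    have nested: "F n (y n) = y 0" for n
      by (induction n) (simp_all add: F0 F_Suc conj)
    have id: "conj_by x id = id" if "x \<in> H" for x
      using that by (intro conj_by_eqI tree_aut_bij mem_carrier) auto
    \<comment> \<open>The element \<open>y n\<close> is conjugate to \<open>p n\<close>, which fixes the levels down to that of \<open>v n\<close>; this property is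
      preserved by every conjugation.\<close>
    have "agree_to_level (length (v n)) (conj_by (y (Suc n)) (p n)) id" for n
      using conj_by_agree_arg[OF mem_carrier[OF y[of "Suc n"]] rigid_stabilizer_agree[OF p(1)[of n]]] y
      by (simp add: id)
    then have near_id: "agree_to_level (length (v n)) (y n) id" for n
      by (simp add: conj)
    have "agree_to_level (length (v (Suc n))) (y n) (p n)" for n
    proof -
      have "agree_to_level (length (v (Suc n))) (conj_by (y (Suc n)) (p n)) (conj_by id (p n))"
        using near_id y p one_closed
        by (intro conj_by_agree mem_carrier) (auto simp: tree_aut_group_def)
      moreover have "conj_by id (p n) = p n" by (rule conj_by_eqI) auto
      ultimately show ?thesis by (simp add: conj)
    qed
    then have "agree_to_level (length (v (Suc n))) (F n (y n)) (F n (p n))" for n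
      using resp y p unfolding nonexpanding_def by blast
    then have "y 0 \<noteq> h n" for n
      using deep[of n] unfolding nested agree_to_level_def by metis
    moreover obtain n where "h n = y 0"
      using enum y[of 0] unfolding h_def by (metis imageE)
    ultimately show False by metis
  qed
qed

section \<open>Grigorchuk's group is weakly branch\<close>

abbreviation grig_generators :: "(bool list \<Rightarrow> bool list) set" where
  "grig_generators \<equiv> {grig_a, grig_b, grig_c, grig_d}"

lemma carrier_grigorchuk_group: "carrier grigorchuk_group = generate tree_aut_group grig_generators"
  using grig_generators_in_tree_aut_group
  by (simp add: grigorchuk_group_def carrier_subgroup_generated Int_absorb1)

lemma subgroup_grigorchuk: "subgroup (carrier grigorchuk_group) tree_aut_group"
  unfolding carrier_grigorchuk_group
  using group.generate_is_subgroup[OF group_tree_aut_group grig_generators_in_tree_aut_group] .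

lemma mult_grigorchuk_group [simp]: "f \<otimes>\<^bsub>grigorchuk_group\<^esub> g = f \<circ> g"
  by (simp add: grigorchuk_group_def subgroup_generated_def tree_aut_group_def)

lemma group_grigorchuk_group: "group grigorchuk_group"
  unfolding grigorchuk_group_def by (rule group.group_subgroup_generated[OF group_tree_aut_group])

lemma grig_generators_subset: "grig_generators \<subseteq> carrier grigorchuk_group"
  unfolding carrier_grigorchuk_group by (auto intro: generate.incl)

lemma grig_generator_involution: "s \<in> grig_generators \<Longrightarrow> s \<circ> s = id"
  by (auto simp: fun_eq_iff grig_a_involution grig_bcd_involution)

text \<open>The generators are involutions, so words without inverses suffice.\<close>

lemma grigorchuk_group_word:
  "f \<in> generate tree_aut_group grig_generators \<Longrightarrow> \<exists>ws \<in> lists grig_generators. f = foldr (\<circ>) ws id"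
proof (induction rule: generate.induct)
  case one
  show ?case by (rule bexI[of _ "[]"]) (auto simp: tree_aut_group_def)
next
  case (incl h)
  then show ?case by (intro bexI[of _ "[h]"]) auto
next
  case (inv h)
  have "inv\<^bsub>tree_aut_group\<^esub> h = h"
    using inv grig_generators_in_tree_aut_group grig_generator_involution[OF inv]
    by (intro group.inv_equality group_tree_aut_group) (auto simp: tree_aut_group_def)
  then show ?case using inv by (intro bexI[of _ "[h]"]) auto
next
  case (eng f g)
  then obtain us vs where uv: "us \<in> lists grig_generators" "f = foldr (\<circ>) us id"
    "vs \<in> lists grig_generators" "g = foldr (\<circ>) vs id" by blast
  have "foldr (\<circ>) us h = foldr (\<circ>) us id \<circ> h" for h :: "bool list \<Rightarrow> bool list"
    by (induction us) (simp_all add: comp_assoc)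
  from this[of g] have "foldr (\<circ>) (us @ vs) id = f \<circ> g"
    by (simp only: foldr_append uv(2) uv(4)[symmetric] comp_apply)
  moreover have "us @ vs \<in> lists grig_generators" using uv(1,3) by simp
  moreover have "f \<otimes>\<^bsub>tree_aut_group\<^esub> g = f \<circ> g" by (simp add: tree_aut_group_def)
  ultimately show ?case by (intro bexI[of _ "us @ vs"]) (simp_all only:)
qed

lemma countable_grigorchuk_group: "countable (carrier grigorchuk_group)"
proof (rule countable_subset)
  show "carrier grigorchuk_group \<subseteq> (\<lambda>ws. foldr (\<circ>) ws id) ` lists grig_generators"
    using grigorchuk_group_word unfolding carrier_grigorchuk_group by blast
  show "countable ((\<lambda>ws. foldr (\<circ>) ws id) ` lists grig_generators)"
    by (intro countable_image countable_lists) simp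
qed

text \<open>Together with the identity, \<open>b\<close>, \<open>c\<close> and \<open>d\<close> form a Klein four-group.\<close>

lemma grig_klein_four [simp]:
  "grig_b (grig_c w) = grig_d w" "grig_c (grig_d w) = grig_b w" "grig_d (grig_b w) = grig_c w"
  by (induction w and w and w rule: grig_b_grig_c_grig_d.induct) (auto simp: grig_a_involution)

lemma grig_klein_four' [simp]:
  "grig_c (grig_b w) = grig_d w" "grig_d (grig_c w) = grig_b w" "grig_b (grig_d w) = grig_c w"
  by (induction w and w and w rule: grig_b_grig_c_grig_d.induct) (auto simp: grig_a_involution)

text \<open>The normal closure of \<open>(ab)\<^sup>2\<close> in Grigorchuk's group. Inverses are obtained from the
  closure under conjugation, because \<open>a (ab)\<^sup>2 a\<close> is the inverse of \<open>(ab)\<^sup>2\<close>.\<close>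

inductive_set branching_set :: "(bool list \<Rightarrow> bool list) set" where
  root: "grig_a \<circ> grig_b \<circ> grig_a \<circ> grig_b \<in> branching_set"
| comp: "k \<in> branching_set \<Longrightarrow> l \<in> branching_set \<Longrightarrow> k \<circ> l \<in> branching_set"
| conj: "s \<in> grig_generators \<Longrightarrow> k \<in> branching_set \<Longrightarrow> s \<circ> k \<circ> s \<in> branching_set"

lemma branching_set_subset:
  assumes "k \<in> branching_set"
  shows "k \<in> carrier grigorchuk_group"
proof -
  have mult: "f \<circ> g \<in> carrier grigorchuk_group"
    if "f \<in> carrier grigorchuk_group" "g \<in> carrier grigorchuk_group" for f g
    using subgroup.m_closed[OF subgroup_grigorchuk that] by (simp add: tree_aut_group_def)
  from assms show ?thesis
  proof (induction rule: branching_set.induct)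
    case root
    show ?case by (intro mult subsetD[OF grig_generators_subset]) simp_all
  next
    case (comp k l)
    then show ?case by (intro mult)
  next
    case (conj s k)
    then have "s \<in> carrier grigorchuk_group" using grig_generators_subset by blast
    with conj.IH show ?case by (intro mult)
  qed
qed

fun act_below :: "bool \<Rightarrow> (bool list \<Rightarrow> bool list) \<Rightarrow> bool list \<Rightarrow> bool list" where
  "act_below x k [] = []"
| "act_below x k (y # w) = y # (if y = x then k w else w)"

text \<open>In terms of the actions on the two subtrees, \<open>t = (ab)\<^sup>2\<close> is \<open>(ca, ac)\<close> and \<open>d\<close> is \<open>(1, b)\<close>. So the
  commutator of \<open>t\<close> and \<open>d\<close> is trivial on the left, and on the right it is \<open>acbcab = abab = t\<close>. To
  conjugate the right-hand action by \<open>a\<close>, \<open>b\<close>, \<open>c\<close> or \<open>d\<close>, conjugate by an element of the group that preserves both subtrees and acts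
  in this way on the right one: \<open>aba = (c, a)\<close>, \<open>d = (1, b)\<close>, \<open>b = (a, c)\<close> or \<open>c = (a, d)\<close>.\<close>

lemma act_below_True_branching_set:
  "k \<in> branching_set \<Longrightarrow> act_below True k \<in> branching_set"
proof (induction rule: branching_set.induct)
  case root
  let ?t = "grig_a \<circ> grig_b \<circ> grig_a \<circ> grig_b"
  \<comment> \<open>The commutator of \<open>t\<close> and \<open>d\<close>, with \<open>a t a\<close> in place of the inverse of \<open>t\<close>.\<close>
  have "act_below True ?t w = (?t \<circ> (grig_d \<circ> (grig_a \<circ> ?t \<circ> grig_a) \<circ> grig_d)) w" for w
    by (cases w rule: grig_a.cases) (simp_all add: grig_a_involution grig_bcd_involution)
  then have "act_below True ?t = ?t \<circ> (grig_d \<circ> (grig_a \<circ> ?t \<circ> grig_a) \<circ> grig_d)" by blast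
  moreover have "\<dots> \<in> branching_set" by (auto intro!: branching_set.intros)
  ultimately show ?case by (simp only:)
next
  case (comp k l)
  have "act_below True (k \<circ> l) w = (act_below True k \<circ> act_below True l) w" for w
    by (cases w) auto
  then have "act_below True (k \<circ> l) = act_below True k \<circ> act_below True l" by blast
  with comp.IH show ?case by (simp only: branching_set.comp)
next
  case (conj s k)
  have "act_below True (grig_a \<circ> k \<circ> grig_a) w
      = (grig_a \<circ> (grig_b \<circ> (grig_a \<circ> act_below True k \<circ> grig_a) \<circ> grig_b) \<circ> grig_a) w"
    "act_below True (grig_b \<circ> k \<circ> grig_b) w = (grig_d \<circ> act_below True k \<circ> grig_d) w"
    "act_below True (grig_c \<circ> k \<circ> grig_c) w = (grig_b \<circ> act_below True k \<circ> grig_b) w"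
    "act_below True (grig_d \<circ> k \<circ> grig_d) w = (grig_c \<circ> act_below True k \<circ> grig_c) w" for w
    by (cases w rule: grig_a.cases; simp add: grig_a_involution grig_bcd_involution)+
  then have "act_below True (grig_a \<circ> k \<circ> grig_a)
      = grig_a \<circ> (grig_b \<circ> (grig_a \<circ> act_below True k \<circ> grig_a) \<circ> grig_b) \<circ> grig_a"
    "act_below True (grig_b \<circ> k \<circ> grig_b) = grig_d \<circ> act_below True k \<circ> grig_d"
    "act_below True (grig_c \<circ> k \<circ> grig_c) = grig_b \<circ> act_below True k \<circ> grig_b"
    "act_below True (grig_d \<circ> k \<circ> grig_d) = grig_c \<circ> act_below True k \<circ> grig_c"
    by blast+
  with conj.hyps(1) conj.IH show ?case
    by (elim insertE emptyE) (simp_all only: branching_set.conj insert_iff simp_thms)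
qed

lemma act_below_branching_set:
  assumes "k \<in> branching_set"
  shows "act_below x k \<in> branching_set"
proof (cases x)
  case True
  with assms show ?thesis by (simp add: act_below_True_branching_set)
next
  case False
  have "act_below False k w = (grig_a \<circ> act_below True k \<circ> grig_a) w" for w
    by (cases w rule: grig_a.cases) simp_all
  then have "act_below False k = grig_a \<circ> act_below True k \<circ> grig_a" by blast
  with False assms show ?thesis
    by (simp add: act_below_True_branching_set branching_set.conj)
qed

text \<open>Iterating \<open>act_below\<close> along \<open>v\<close> transports nontrivial elements of the branching set to the
  rigid stabiliser of \<open>v\<close>.\<close>

lemma weakly_branch_grigorchuk_group: "weakly_branch (carrier grigorchuk_group)"
proof -
  have "\<exists>k \<in> branching_set \<inter> rigid_stabilizer v. k \<noteq> id" for v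
  proof (induction v)
    case Nil
    let ?t = "grig_a \<circ> grig_b \<circ> grig_a \<circ> grig_b"
    have "?t [False, False] \<noteq> id [False, False]" by simp
    then have "?t \<noteq> id" by metis
    moreover have "?t \<in> branching_set \<inter> rigid_stabilizer []"
      using branching_set.root by (simp add: rigid_stabilizer_def strict_prefix_def)
    ultimately show ?case by blast
  next
    case (Cons x v)
    then obtain k where k: "k \<in> branching_set" "k \<in> rigid_stabilizer v" "k \<noteq> id" by blast
    from k(3) obtain w where "k w \<noteq> w" by (auto simp: fun_eq_iff)
    then have "act_below x k (x # w) \<noteq> id (x # w)" by simp
    then have "act_below x k \<noteq> id" by metis
    moreover have "act_below x k w = w" if "\<not> strict_prefix (x # v) w" for w
      using k(2) that by (cases w) (auto simp: rigid_stabilizer_def)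
    then have "act_below x k \<in> branching_set \<inter> rigid_stabilizer (x # v)"
      using act_below_branching_set[OF k(1)] by (simp add: rigid_stabilizer_def)
    ultimately show ?case by blast
  qed
  then show ?thesis
    using branching_set_subset unfolding weakly_branch_def by blast
qed

section \<open>Ultrafilters and countable completeness\<close>

lemma ultrafilter_on_superset:
  assumes U: "ultrafilter_on S U" and "Y \<in> U" "Y \<subseteq> Z" "Z \<subseteq> S"
  shows "Z \<in> U"
proof (rule ccontr)
  assume "Z \<notin> U"
  with U \<open>Z \<subseteq> S\<close> have "S - Z \<in> U" by (auto simp: ultrafilter_on_def)
  with U \<open>Y \<in> U\<close> have "Y \<inter> (S - Z) \<in> U" by (auto simp: ultrafilter_on_def)
  moreover have "Y \<inter> (S - Z) = {}" using \<open>Y \<subseteq> Z\<close> by blast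
  ultimately show False using U by (simp add: ultrafilter_on_def)
qed

lemma ultrafilter_on_inter: "ultrafilter_on S U \<Longrightarrow> Y \<in> U \<Longrightarrow> Z \<in> U \<Longrightarrow> Y \<inter> Z \<in> U"
  by (auto simp: ultrafilter_on_def)

lemma ultrafilter_on_subset: "ultrafilter_on S U \<Longrightarrow> Y \<in> U \<Longrightarrow> Y \<subseteq> S"
  by (auto simp: ultrafilter_on_def)

lemma ultrafilter_on_space: "ultrafilter_on S U \<Longrightarrow> S \<in> U"
  by (auto simp: ultrafilter_on_def)

lemma ultrafilter_on_compl_iff:
  assumes "ultrafilter_on S U" "Y \<subseteq> S"
  shows "S - Y \<in> U \<longleftrightarrow> Y \<notin> U"
proof -
  have "Y \<inter> (S - Y) = {}" by blast
  with assms show ?thesis unfolding ultrafilter_on_def by metis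
qed

definition countably_complete_on :: "'i set \<Rightarrow> 'i set set \<Rightarrow> bool" where
  "countably_complete_on S U \<longleftrightarrow> (\<forall>B. (\<forall>n :: nat. B n \<in> U) \<longrightarrow> S \<inter> (\<Inter>n. B n) \<in> U)"

lemma countably_incomplete_chain:
  assumes U: "ultrafilter_on S U" and "\<not> countably_complete_on S U"
  obtains B where "\<And>n :: nat. B n \<in> U" "decseq B" "(\<Inter>n. B n) = {}"
proof -
  from assms(2) obtain Y where Y: "\<And>n :: nat. Y n \<in> U" and "S \<inter> (\<Inter>n. Y n) \<notin> U"
    by (auto simp: countably_complete_on_def)
  then have compl: "S - (S \<inter> (\<Inter>n. Y n)) \<in> U"
    using ultrafilter_on_compl_iff[OF U] by blast
  have fin: "(\<Inter>k\<le>n. Y k) \<in> U" for n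
    using Y by (induction n) (simp_all add: atMost_Suc ultrafilter_on_inter[OF U])
  show thesis
  proof (rule that)
    show "(S - (S \<inter> (\<Inter>n. Y n))) \<inter> (\<Inter>k\<le>n. Y k) \<in> U" for n
      using fin compl by (intro ultrafilter_on_inter[OF U])
    show "decseq (\<lambda>n. (S - (S \<inter> (\<Inter>n. Y n))) \<inter> (\<Inter>k\<le>n. Y k))"
      by (force simp: decseq_def)
    show "(\<Inter>n. (S - (S \<inter> (\<Inter>n. Y n))) \<inter> (\<Inter>k\<le>n. Y k)) = {}"
      by auto
  qed
qed

section \<open>Nested conjugation in ultraproducts\<close>

text \<open>Set the \<open>N\<close>-th unknown to \<open>\<one>\<close> and compute backwards.\<close>

lemma (in group) finite_nested_conjugation:
  assumes q: "\<And>n :: nat. q n \<in> carrier G"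
  shows "\<exists>y. (\<forall>n. y n \<in> carrier G) \<and> (\<forall>n<N. y n \<otimes> y (Suc n) = y (Suc n) \<otimes> q n)"
proof -
  define z where "z = rec_nat \<one> (\<lambda>k x. x \<otimes> q (N - Suc k) \<otimes> inv x)"
  have z0: "z 0 = \<one>" and zS: "z (Suc k) = z k \<otimes> q (N - Suc k) \<otimes> inv (z k)" for k
    by (simp_all add: z_def)
  have z: "z k \<in> carrier G" for k
    using q by (induction k) (simp_all add: z0 zS)
  show ?thesis
  proof (intro exI[of _ "\<lambda>n. z (N - n)"] conjI allI impI)
    fix n assume "n < N"
    then have "N - n = Suc (N - Suc n)" "N - Suc (N - Suc n) = n" by auto
    then show "z (N - n) \<otimes> z (N - Suc n) = z (N - Suc n) \<otimes> q n"
      using z q by (simp add: zS m_assoc)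
  qed (rule z)
qed

text \<open>A name for the normal subgroup by which the ultraproduct divides the full product.\<close>

definition ultra_kernel :: "'i set \<Rightarrow> ('i \<Rightarrow> 'g monoid) \<Rightarrow> 'i set set \<Rightarrow> ('i \<Rightarrow> 'g) set" where
  "ultra_kernel I G U = {x \<in> carrier (product_group I G). {i \<in> I. x i = \<one>\<^bsub>G i\<^esub>} \<in> U}"

lemma ultraproduct_eq: "ultraproduct I G U = product_group I G Mod ultra_kernel I G U"
  by (simp add: ultraproduct_def ultra_kernel_def)

lemma normal_ultra_kernel:
  assumes G: "\<And>i. i \<in> I \<Longrightarrow> group (G i)" and U: "ultrafilter_on I U"
  shows "ultra_kernel I G U \<lhd> product_group I G"
proof -
  interpret P: group "product_group I G" using G by simp
  note up = ultrafilter_on_superset[OF U] and int = ultrafilter_on_inter[OF U]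
  have sub: "subgroup (ultra_kernel I G U) (product_group I G)"
  proof (rule P.subgroupI)
    show "ultra_kernel I G U \<subseteq> carrier (product_group I G)"
      by (auto simp: ultra_kernel_def)
    have "{i \<in> I. \<one>\<^bsub>product_group I G\<^esub> i = \<one>\<^bsub>G i\<^esub>} = I" by auto
    then have "\<one>\<^bsub>product_group I G\<^esub> \<in> ultra_kernel I G U"
      using ultrafilter_on_space[OF U] P.one_closed by (simp only: ultra_kernel_def mem_Collect_eq simp_thms)
    then show "ultra_kernel I G U \<noteq> {}" by blast
  next
    fix x assume x: "x \<in> ultra_kernel I G U"
    then have xc: "x \<in> carrier (product_group I G)" and xU: "{i \<in> I. x i = \<one>\<^bsub>G i\<^esub>} \<in> U"
      by (auto simp only: ultra_kernel_def)
    have "{i \<in> I. (inv\<^bsub>product_group I G\<^esub> x) i = \<one>\<^bsub>G i\<^esub>} \<in> U"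
      by (rule up[OF xU]) (use xc G in \<open>auto simp: group.is_monoid monoid.inv_one\<close>)
    then show "inv\<^bsub>product_group I G\<^esub> x \<in> ultra_kernel I G U"
      using P.inv_closed[OF xc] by (simp only: ultra_kernel_def mem_Collect_eq simp_thms)
  next
    fix x y assume "x \<in> ultra_kernel I G U" "y \<in> ultra_kernel I G U"
    then have c: "x \<in> carrier (product_group I G)" "y \<in> carrier (product_group I G)"
      and xU: "{i \<in> I. x i = \<one>\<^bsub>G i\<^esub>} \<in> U" "{i \<in> I. y i = \<one>\<^bsub>G i\<^esub>} \<in> U"
      by (auto simp only: ultra_kernel_def)
    have "{i \<in> I. (x \<otimes>\<^bsub>product_group I G\<^esub> y) i = \<one>\<^bsub>G i\<^esub>} \<in> U"
      by (rule up[OF int[OF xU]]) (use G in \<open>auto simp: group.is_monoid\<close>)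
    then show "x \<otimes>\<^bsub>product_group I G\<^esub> y \<in> ultra_kernel I G U"
      using P.m_closed[OF c] by (simp only: ultra_kernel_def mem_Collect_eq simp_thms)
  qed
  moreover have "x \<otimes>\<^bsub>product_group I G\<^esub> h \<otimes>\<^bsub>product_group I G\<^esub> inv\<^bsub>product_group I G\<^esub> x \<in> ultra_kernel I G U"
    if x: "x \<in> carrier (product_group I G)" and h: "h \<in> ultra_kernel I G U" for x h
  proof -
    have xi: "x i \<in> carrier (G i)" if "i \<in> I" for i using x that by auto
    from h have hc: "h \<in> carrier (product_group I G)" and hU: "{i \<in> I. h i = \<one>\<^bsub>G i\<^esub>} \<in> U"
      by (auto simp only: ultra_kernel_def)
    have "{i \<in> I. (x \<otimes>\<^bsub>product_group I G\<^esub> h \<otimes>\<^bsub>product_group I G\<^esub> inv\<^bsub>product_group I G\<^esub> x) i = \<one>\<^bsub>G i\<^esub>} \<in> U"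
    proof (rule up[OF hU])
      show "{i \<in> I. h i = \<one>\<^bsub>G i\<^esub>}
        \<subseteq> {i \<in> I. (x \<otimes>\<^bsub>product_group I G\<^esub> h \<otimes>\<^bsub>product_group I G\<^esub> inv\<^bsub>product_group I G\<^esub> x) i = \<one>\<^bsub>G i\<^esub>}"
        using x xi G by (auto simp: group.r_inv group.is_monoid monoid.r_one)
    qed blast
    then show ?thesis
      using P.m_closed[OF P.m_closed[OF x hc] P.inv_closed[OF x]]
      by (simp only: ultra_kernel_def mem_Collect_eq simp_thms)
  qed
  ultimately show ?thesis by (simp only: P.normal_inv_iff) blast
qed

lemma ultraproduct_coset_eqI:
  assumes G: "\<And>i. i \<in> I \<Longrightarrow> group (G i)" and U: "ultrafilter_on I U"
    and x: "x \<in> carrier (product_group I G)" and y: "y \<in> carrier (product_group I G)"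
    and eq: "{i \<in> I. x i = y i} \<in> U"
  shows "ultra_kernel I G U #>\<^bsub>product_group I G\<^esub> x = ultra_kernel I G U #>\<^bsub>product_group I G\<^esub> y"
proof -
  interpret P: group "product_group I G" using G by simp
  interpret N: normal "ultra_kernel I G U" "product_group I G" by (rule normal_ultra_kernel[OF G U])
  let ?d = "x \<otimes>\<^bsub>product_group I G\<^esub> inv\<^bsub>product_group I G\<^esub> y"
  have d: "?d \<in> carrier (product_group I G)" using x y by (intro P.m_closed P.inv_closed)
  have yi: "y i \<in> carrier (G i)" if "i \<in> I" for i using y that by auto
  have "{i \<in> I. ?d i = \<one>\<^bsub>G i\<^esub>} \<in> U"
    by (rule ultrafilter_on_superset[OF U eq]) (use y yi G in \<open>auto simp: group.r_inv\<close>)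
  with d have dN: "?d \<in> ultra_kernel I G U" by (simp only: ultra_kernel_def mem_Collect_eq simp_thms)
  have "x = ?d \<otimes>\<^bsub>product_group I G\<^esub> y"
    using x y by (simp only: P.m_assoc P.inv_closed P.l_inv P.r_one)
  then have "ultra_kernel I G U #>\<^bsub>product_group I G\<^esub> x
      = (ultra_kernel I G U #>\<^bsub>product_group I G\<^esub> ?d) #>\<^bsub>product_group I G\<^esub> y"
    using P.coset_mult_assoc[OF N.subset d y] by (simp only:)
  then show ?thesis
    using P.coset_join2[OF d N.subgroup_axioms dN] by (simp only:)
qed

text \<open>Lift the parameters to the product of the groups, and let \<open>B\<close> be a decreasing sequence in \<open>U\<close> with empty
  intersection. A coordinate \<open>i\<close> has to satisfy the \<open>n\<close>-th equation only if it lies in \<open>B n\<close>, which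
  for fixed \<open>i\<close> concerns finitely many \<open>n\<close>. So each coordinate has to solve a finite system, and every
  single equation holds on a member of \<open>U\<close>.\<close>

lemma ultraproduct_nested_conjugation:
  assumes G: "\<And>i. i \<in> I \<Longrightarrow> group (G i)" and U: "ultrafilter_on I U"
    and inc: "\<not> countably_complete_on I U" and h: "h \<in> epi (ultraproduct I G U) H"
    and p: "\<And>n :: nat. p n \<in> carrier H"
  shows "\<exists>y. (\<forall>n. y n \<in> carrier H) \<and> (\<forall>n. y n \<otimes>\<^bsub>H\<^esub> y (Suc n) = y (Suc n) \<otimes>\<^bsub>H\<^esub> p n)"
proof -
  let ?P = "product_group I G" and ?N = "ultra_kernel I G U"
  interpret P: group ?P using G by simp
  interpret N: normal ?N ?P by (rule normal_ultra_kernel[OF G U])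
  define \<pi> where "\<pi> = (\<lambda>x. h (?N #>\<^bsub>?P\<^esub> x))"
  have hom: "\<pi> \<in> hom ?P H"
    using hom_compose[OF N.r_coset_hom_Mod, of h H] h
    by (simp add: \<pi>_def epi_def ultraproduct_eq comp_def)
  have surj: "\<pi> ` carrier ?P = carrier H"
    using h by (simp only: \<pi>_def epi_def ultraproduct_eq carrier_FactGroup mem_Collect_eq image_image)
  obtain B where B: "\<And>n :: nat. B n \<in> U" "decseq B" "(\<Inter>n. B n) = {}"
    using countably_incomplete_chain[OF U inc] by blast
  from p surj have "\<forall>n. \<exists>q. q \<in> carrier ?P \<and> \<pi> q = p n" by (metis imageE)
  then obtain q where q: "\<And>n. q n \<in> carrier ?P" "\<And>n. \<pi> (q n) = p n" by metis
  have "\<forall>i. \<exists>N. i \<notin> B N" using B(3) by blast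
  then obtain N where N: "\<And>i. i \<notin> B (N i)" by metis
  have "\<exists>z. (\<forall>n. z n \<in> carrier (G i)) \<and> (\<forall>n<N i. z n \<otimes>\<^bsub>G i\<^esub> z (Suc n) = z (Suc n) \<otimes>\<^bsub>G i\<^esub> q n i)"
    if "i \<in> I" for i
    using q(1) that by (intro group.finite_nested_conjugation G) auto
  then obtain z where z: "\<And>i n. i \<in> I \<Longrightarrow> z i n \<in> carrier (G i)"
    "\<And>i n. i \<in> I \<Longrightarrow> n < N i \<Longrightarrow> z i n \<otimes>\<^bsub>G i\<^esub> z i (Suc n) = z i (Suc n) \<otimes>\<^bsub>G i\<^esub> q n i"
    by metis
  define Y where "Y n = (\<lambda>i\<in>I. z i n)" for n
  have Y: "Y n \<in> carrier ?P" for n using z(1) by (auto simp: Y_def)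
  have eqn: "\<pi> (Y n \<otimes>\<^bsub>?P\<^esub> Y (Suc n)) = \<pi> (Y (Suc n) \<otimes>\<^bsub>?P\<^esub> q n)" for n
  proof -
    have "B n \<subseteq> {i \<in> I. (Y n \<otimes>\<^bsub>?P\<^esub> Y (Suc n)) i = (Y (Suc n) \<otimes>\<^bsub>?P\<^esub> q n) i}"
    proof
      fix i assume i: "i \<in> B n"
      with B(1) ultrafilter_on_subset[OF U] have "i \<in> I" by blast
      moreover have "n < N i"
      proof (rule ccontr)
        assume "\<not> n < N i"
        with B(2) have "B n \<subseteq> B (N i)" by (simp add: decseq_def)
        with i N show False by blast
      qed
      ultimately show "i \<in> {i \<in> I. (Y n \<otimes>\<^bsub>?P\<^esub> Y (Suc n)) i = (Y (Suc n) \<otimes>\<^bsub>?P\<^esub> q n) i}"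
        using z(2) by (simp add: Y_def)
    qed
    then have "{i \<in> I. (Y n \<otimes>\<^bsub>?P\<^esub> Y (Suc n)) i = (Y (Suc n) \<otimes>\<^bsub>?P\<^esub> q n) i} \<in> U"
      by (rule ultrafilter_on_superset[OF U B(1)]) blast
    then show ?thesis
      unfolding \<pi>_def
      using ultraproduct_coset_eqI[OF G U P.m_closed[OF Y Y] P.m_closed[OF Y q(1)]] by simp
  qed
  show ?thesis
  proof (intro exI[of _ "\<lambda>n. \<pi> (Y n)"] conjI allI)
    show "\<pi> (Y n) \<in> carrier H" for n using surj Y by blast
    show "\<pi> (Y n) \<otimes>\<^bsub>H\<^esub> \<pi> (Y (Suc n)) = \<pi> (Y (Suc n)) \<otimes>\<^bsub>H\<^esub> p n" for n
      using eqn[of n] hom_mult[OF hom Y Y] hom_mult[OF hom Y q(1)] by (simp only: q(2))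
  qed
qed

section \<open>Measurable cardinals from countably complete ultrafilters\<close>

text \<open>Let \<open>J\<close> be a family of least cardinality among the subfamilies of \<open>U\<close> whose intersection is not in
  \<open>U\<close>; the complements of points form such a family, so \<open>J\<close> is no larger than the index type. Almost every
  point is missed by some member of \<open>J\<close>, and sending it to one of these pushes \<open>U\<close> forward to an ultrafilter
  on \<open>J\<close>. It is nonprincipal as the points sent to \<open>B\<close> lie outside \<open>B \<in> U\<close>, and it inherits from \<open>U\<close> closure under
  intersections of fewer than \<open>|J|\<close> sets.\<close>

lemma countably_complete_imp_measurable_cardinal:
  fixes U :: "'i set set"
  assumes U: "ultrafilter_on I U" and np: "nonprincipal_on I U" and cc: "countably_complete_on I U"
  shows "\<exists>\<kappa> :: 'i rel. measurable_cardinal \<kappa>"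
proof -
  define bad where "bad J \<longleftrightarrow> J \<subseteq> U \<and> I \<inter> \<Inter>J \<notin> U" for J
  have "\<exists>J. bad J \<and> |J| \<le>o |UNIV :: 'i set|"
  proof (intro exI conjI)
    let ?J = "(\<lambda>x. I - {x}) ` I"
    have "I \<inter> \<Inter>?J = {}" by auto
    moreover have "?J \<subseteq> U"
      using np ultrafilter_on_compl_iff[OF U] by (auto simp: nonprincipal_on_def)
    ultimately show "bad ?J" using U by (simp add: bad_def ultrafilter_on_def)
    show "|?J| \<le>o |UNIV :: 'i set|"
      by (meson card_of_image card_of_mono1 ordLeq_transitive subset_UNIV)
  qed
  then obtain J0 where J0: "bad J0" "|J0| \<le>o |UNIV :: 'i set|" by blast
  define Q where "Q = card_of ` {J. bad J \<and> |J| \<le>o |UNIV :: 'i set|}"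
  have "|J0| \<in> Q" using J0 by (simp add: Q_def)
  then have "\<exists>r\<in>Q. \<forall>r'. r' <o r \<longrightarrow> r' \<notin> Q"
    by (rule wf_ordLess[unfolded wf_eq_minimal, rule_format])
  then obtain r where r: "r \<in> Q" and r_min: "\<forall>r'. r' <o r \<longrightarrow> r' \<notin> Q"
    by (elim bexE)
  from r obtain J where J: "bad J" "|J| \<le>o |UNIV :: 'i set|" and rJ: "r = |J|"
    by (auto simp: Q_def)
  have least: "\<not> |J'| <o |J|" if "bad J'" "|J'| \<le>o |UNIV :: 'i set|" for J'
  proof -
    from that have "|J'| \<in> Q" by (simp add: Q_def)
    with r_min show ?thesis unfolding rJ by metis
  qed
  have minimal: "I \<inter> \<Inter>J' \<in> U" if "J' \<subseteq> U" "|J'| <o |J|" for J'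
    using that least[of J'] J(2) ordLess_ordLeq_trans ordLess_imp_ordLeq unfolding bad_def by blast
  \<comment> \<open>The injection \<open>g\<close> moves \<open>J\<close> into the index type, where the cardinal has to live.\<close>
  from J(2) obtain g :: "'i set \<Rightarrow> 'i" where g: "inj_on g J"
    unfolding card_of_ordLeq[symmetric] by blast
  let ?A = "I - (I \<inter> \<Inter>J)"
  have A: "?A \<in> U" using J(1) ultrafilter_on_compl_iff[OF U] by (simp add: bad_def)
  have "\<forall>i. i \<in> ?A \<longrightarrow> (\<exists>B. B \<in> J \<and> i \<notin> B)" by blast
  then obtain c where c: "\<And>i. i \<in> ?A \<Longrightarrow> c i \<in> J \<and> i \<notin> c i" by metis
  let ?S = "g ` J"
  define pre where "pre Y = {i \<in> ?A. g (c i) \<in> Y}" for Y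
  define V where "V = {Y. Y \<subseteq> ?S \<and> pre Y \<in> U}"
  have preI: "pre Y \<subseteq> I" for Y by (auto simp: pre_def)
  have "ultrafilter_on ?S V"
    unfolding ultrafilter_on_def
  proof (intro conjI allI impI ballI)
    show "V \<subseteq> Pow ?S" by (auto simp: V_def)
    show "{} \<notin> V" using U by (simp add: V_def pre_def ultrafilter_on_def)
    show "Y \<in> V \<or> ?S - Y \<in> V" if "Y \<subseteq> ?S" for Y
    proof (cases "pre Y \<in> U")
      case False
      then have "?A \<inter> (I - pre Y) \<in> U"
        using A ultrafilter_on_compl_iff[OF U preI] ultrafilter_on_inter[OF U] by blast
      moreover have "?A \<inter> (I - pre Y) = pre (?S - Y)" using c by (auto simp: pre_def)
      ultimately show ?thesis by (auto simp: V_def)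
    qed (use that in \<open>auto simp: V_def\<close>)
    show "Y \<inter> Z \<in> V" if "Y \<in> V" "Z \<in> V" for Y Z
    proof -
      have "pre Y \<inter> pre Z = pre (Y \<inter> Z)" by (auto simp: pre_def)
      with that ultrafilter_on_inter[OF U, of "pre Y" "pre Z"] show ?thesis by (auto simp: V_def)
    qed
  qed
  moreover have "nonprincipal_on ?S V"
    unfolding nonprincipal_on_def
  proof (safe)
    fix B assume B: "B \<in> J" and "{g B} \<in> V"
    then have "pre {g B} \<in> U" by (simp add: V_def)
    moreover have "pre {g B} \<subseteq> I - B" using c B g by (auto simp: pre_def dest!: inj_onD)
    ultimately have "I - B \<in> U" using ultrafilter_on_superset[OF U] by blast
    moreover have "B \<in> U" using B J(1) by (auto simp: bad_def)
    ultimately show False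
      using ultrafilter_on_compl_iff[OF U] ultrafilter_on_subset[OF U] by blast
  qed
  moreover have SJ: "|?S| =o |J|"
    using g by (meson bij_betw_imageI card_of_ordIso ordIso_symmetric)
  have "complete_on |?S| ?S V"
    unfolding complete_on_def
  proof (intro allI impI, elim conjE)
    fix \<J> assume sub: "\<J> \<subseteq> V" and small: "|\<J>| <o |?S|"
    have "|pre ` \<J>| <o |J|"
      using ordLess_ordIso_trans[OF ordLeq_ordLess_trans[OF card_of_image small] SJ] .
    moreover have "pre ` \<J> \<subseteq> U" using sub by (auto simp: V_def)
    ultimately have "?A \<inter> (I \<inter> \<Inter>(pre ` \<J>)) \<in> U"
      using minimal A ultrafilter_on_inter[OF U] by blast
    moreover have "?A \<inter> (I \<inter> \<Inter>(pre ` \<J>)) = pre (?S \<inter> \<Inter>\<J>)"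
      using c by (auto simp: pre_def)
    ultimately show "?S \<inter> \<Inter>\<J> \<in> V" by (auto simp: V_def)
  qed
  moreover have "natLeq <o |?S|"
  proof (rule ccontr)
    assume "\<not> natLeq <o |?S|"
    then have "|?S| \<le>o natLeq"
      using not_ordLess_iff_ordLeq natLeq_Well_order card_of_Well_order by blast
    then have "|J| \<le>o |UNIV :: nat set|"
      using SJ card_of_nat by (meson ordIso_ordLeq_trans ordIso_symmetric ordLeq_ordIso_trans)
    then have J': "countable J"
      unfolding countable_def card_of_ordLeq[symmetric] by blast
    have "I \<inter> \<Inter>J \<in> U"
    proof (cases "J = {}")
      case True
      then show ?thesis by (simp add: ultrafilter_on_space[OF U])
    next
      case False
      then have J'': "range (from_nat_into J) = J" using J' by (rule range_from_nat_into)
      moreover have "from_nat_into J n \<in> U" for n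
        using J(1) from_nat_into[OF False] unfolding bad_def by blast
      ultimately show ?thesis using cc unfolding countably_complete_on_def by metis
    qed
    with J(1) show False by (simp add: bad_def)
  qed
  ultimately have "measurable_cardinal |?S|"
    unfolding measurable_cardinal_def
    by (intro conjI exI[of _ ?S] exI[of _ V] card_of_Card_order card_of_refl)
  then show ?thesis by blast
qed

section \<open>Ultrapowers of countable groups\<close>

lemma measurable_cardinal_countably_complete:
  assumes "natLeq <o \<kappa>" "complete_on \<kappa> S U"
  shows "countably_complete_on S U"
  unfolding countably_complete_on_def
proof (intro allI impI)
  fix B :: "nat \<Rightarrow> _" assume "\<forall>n. B n \<in> U"
  moreover have "|range B| <o \<kappa>"
    using ordLeq_ordLess_trans[OF ordLeq_ordIso_trans[OF card_of_image card_of_nat] assms(1)] .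
  ultimately show "S \<inter> (\<Inter>n. B n) \<in> U"
    using assms(2) unfolding complete_on_def by blast
qed

text \<open>Otherwise the countably many complements of the fibres are in \<open>U\<close>, and so is their intersection, which is empty.\<close>

lemma countably_complete_constant:
  assumes U: "ultrafilter_on S U" and cc: "countably_complete_on S U"
    and C: "countable C" and f: "\<And>i. i \<in> S \<Longrightarrow> f i \<in> C"
  shows "\<exists>c\<in>C. {i \<in> S. f i = c} \<in> U"
proof (rule ccontr)
  assume "\<not> ?thesis"
  then have "S - {i \<in> S. f i = c} \<in> U" if "c \<in> C" for c
    using that by (subst ultrafilter_on_compl_iff[OF U]) auto
  moreover have "S \<noteq> {}" using ultrafilter_on_space[OF U] U by (auto simp: ultrafilter_on_def)
  then have "C \<noteq> {}" using f by blast
  moreover from this have C': "range (from_nat_into C) = C" using C by (rule range_from_nat_into)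
  ultimately have "S - {i \<in> S. f i = from_nat_into C n} \<in> U" for n by blast
  then have "S \<inter> (\<Inter>n. S - {i \<in> S. f i = from_nat_into C n}) \<in> U"
    using spec[OF cc[unfolded countably_complete_on_def], of "\<lambda>n. S - {i \<in> S. f i = from_nat_into C n}"]
    by blast
  moreover have "S \<inter> (\<Inter>n. S - {i \<in> S. f i = from_nat_into C n}) = {}"
  proof -
    have "\<exists>n. f i = from_nat_into C n" if "i \<in> S" for i
      using f[OF that] C' by (metis imageE)
    then show ?thesis by blast
  qed
  ultimately show False using U by (simp add: ultrafilter_on_def)
qed

text \<open>Send a class in the ultrapower to the value that its representatives take on a member of \<open>U\<close>. The factors are a copy of
  \<open>H\<close> on a countable subset of \<open>'g\<close>.\<close>

lemma countable_group_image_of_ultrapower: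
  fixes H :: "('h, 'b) monoid_scheme"
  assumes inf: "infinite (UNIV :: 'g set)" and H: "group H" and C: "countable (carrier H)"
    and U: "ultrafilter_on S U" and cc: "countably_complete_on S U"
  shows "\<exists>(G :: 'g monoid) h. group G \<and> h \<in> epi (ultraproduct S (\<lambda>i. G) U) H"
proof -
  interpret H: group H by fact
  obtain f :: "nat \<Rightarrow> 'g" where f: "inj f" using infinite_countable_subset[OF inf] by blast
  define e where "e = f \<circ> to_nat_on (carrier H)"
  have e: "inj_on e (carrier H)"
    unfolding e_def using inj_on_to_nat_on[OF C] f by (auto intro: comp_inj_on inj_on_subset)
  define G where "G = image_group e H"
  have G: "group G" unfolding G_def by (rule H.inj_imp_image_group_is_group[OF e])
  let ?P = "product_group S (\<lambda>i. G)"
  have carG: "carrier G = e ` carrier H" by (simp add: G_def image_group_carrier)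
  have one: "\<one>\<^bsub>G\<^esub> = e \<one>\<^bsub>H\<^esub>" by (simp add: G_def image_group_one)
  have mult: "e a \<otimes>\<^bsub>G\<^esub> e b = e (a \<otimes>\<^bsub>H\<^esub> b)" if "a \<in> carrier H" "b \<in> carrier H" for a b
    using that e by (simp add: G_def image_group_def)
  have ex: "\<exists>c. c \<in> carrier H \<and> {i \<in> S. x i = e c} \<in> U" if "x \<in> carrier ?P" for x
    using countably_complete_constant[OF U cc countable_image[OF C, of e], of x] that
    by (auto simp: carG)
  define k where "k x = (SOME c. c \<in> carrier H \<and> {i \<in> S. x i = e c} \<in> U)" for x
  have k: "k x \<in> carrier H" "{i \<in> S. x i = e (k x)} \<in> U" if "x \<in> carrier ?P" for x
    using someI_ex[OF ex[OF that]] by (auto simp: k_def)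
  have k_eqI: "k x = c" if x: "x \<in> carrier ?P" and c: "c \<in> carrier H" "{i \<in> S. x i = e c} \<in> U" for x c
  proof -
    have "{i \<in> S. x i = e (k x)} \<inter> {i \<in> S. x i = e c} \<noteq> {}"
      using ultrafilter_on_inter[OF U k(2)[OF x] c(2)] U by (auto simp: ultrafilter_on_def)
    then have "e (k x) = e c" by auto
    with e k(1)[OF x] c(1) show ?thesis by (simp add: inj_on_eq_iff)
  qed
  interpret P: group ?P using G by simp
  have hom: "k \<in> hom ?P H"
  proof (rule homI)
    show "k x \<in> carrier H" if "x \<in> carrier ?P" for x using k(1)[OF that] .
    fix x y assume x: "x \<in> carrier ?P" and y: "y \<in> carrier ?P"
    have "{i \<in> S. (x \<otimes>\<^bsub>?P\<^esub> y) i = e (k x \<otimes>\<^bsub>H\<^esub> k y)} \<in> U"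
      by (rule ultrafilter_on_superset[OF U ultrafilter_on_inter[OF U k(2)[OF x] k(2)[OF y]]])
        (use k(1)[OF x] k(1)[OF y] in \<open>auto simp: mult\<close>)
    then show "k (x \<otimes>\<^bsub>?P\<^esub> y) = k x \<otimes>\<^bsub>H\<^esub> k y"
      using x y k(1) by (intro k_eqI P.m_closed H.m_closed)
  qed
  interpret k: group_hom ?P H k by unfold_locales (rule hom)
  have "k ` carrier ?P = carrier H"
  proof
    show "k ` carrier ?P \<subseteq> carrier H" using k(1) by blast
    show "carrier H \<subseteq> k ` carrier ?P"
    proof
      fix c assume c: "c \<in> carrier H"
      let ?x = "\<lambda>i\<in>S. e c"
      have x: "?x \<in> carrier ?P" using c by (auto simp: carG)
      have "{i \<in> S. ?x i = e c} = S" by auto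
      then have "k ?x = c" using c x ultrafilter_on_space[OF U] by (intro k_eqI) simp_all
      with x show "c \<in> k ` carrier ?P" by (metis imageI)
    qed
  qed
  then have iso: "(\<lambda>B. the_elem (k ` B)) \<in> iso (?P Mod kernel ?P H k) H"
    by (rule k.FactGroup_iso_set)
  have "k x = \<one>\<^bsub>H\<^esub> \<longleftrightarrow> {i \<in> S. x i = \<one>\<^bsub>G\<^esub>} \<in> U" if "x \<in> carrier ?P" for x
    using k(2)[OF that] k_eqI[OF that H.one_closed] by (auto simp: one)
  then have "kernel ?P H k = ultra_kernel S (\<lambda>i. G) U"
    by (auto simp only: kernel_def ultra_kernel_def)
  with iso have "(\<lambda>B. the_elem (k ` B)) \<in> epi (ultraproduct S (\<lambda>i. G) U) H"
    by (simp add: iso_iff_mon_epi ultraproduct_eq)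
  with G show ?thesis by blast
qed

section \<open>Images of ultraproducts\<close>

theorem theorem2:
  assumes "infinite (UNIV :: 'g set)"
  shows "(\<exists>(I :: 'i set) (G :: 'i \<Rightarrow> 'g monoid) U h.
            (\<forall>i\<in>I. group (G i)) \<and> ultrafilter_on I U \<and> nonprincipal_on I U \<and>
            h \<in> epi (ultraproduct I G U) grigorchuk_group)
         \<longleftrightarrow> (\<exists>\<kappa> :: 'i rel. measurable_cardinal \<kappa>)"
proof
  assume "\<exists>(I :: 'i set) (G :: 'i \<Rightarrow> 'g monoid) U h.
            (\<forall>i\<in>I. group (G i)) \<and> ultrafilter_on I U \<and> nonprincipal_on I U \<and>
            h \<in> epi (ultraproduct I G U) grigorchuk_group"
  then obtain I :: "'i set" and G :: "'i \<Rightarrow> 'g monoid" and U h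
    where G: "\<And>i. i \<in> I \<Longrightarrow> group (G i)" and U: "ultrafilter_on I U" "nonprincipal_on I U"
      and h: "h \<in> epi (ultraproduct I G U) grigorchuk_group"
    by blast
  obtain p where p: "\<And>n :: nat. p n \<in> carrier grigorchuk_group"
    and unsolvable: "\<And>y. (\<And>n :: nat. y n \<in> carrier grigorchuk_group)
      \<Longrightarrow> (\<And>n. y n \<circ> y (Suc n) = y (Suc n) \<circ> p n) \<Longrightarrow> False"
    using nested_conjugation_unsolvable[OF subgroup_grigorchuk countable_grigorchuk_group
        weakly_branch_grigorchuk_group] by blast
  have "countably_complete_on I U"
  proof (rule ccontr)
    assume "\<not> countably_complete_on I U"
    then have "\<exists>y. (\<forall>n. y n \<in> carrier grigorchuk_group) \<and> (\<forall>n. y n \<circ> y (Suc n) = y (Suc n) \<circ> p n)"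
      using ultraproduct_nested_conjugation[OF G U(1) _ h p] by simp
    with unsolvable show False by blast
  qed
  with U show "\<exists>\<kappa> :: 'i rel. measurable_cardinal \<kappa>"
    by (rule countably_complete_imp_measurable_cardinal)
next
  assume "\<exists>\<kappa> :: 'i rel. measurable_cardinal \<kappa>"
  then obtain \<kappa> :: "'i rel" and S :: "'i set" and U where "natLeq <o \<kappa>" "complete_on \<kappa> S U"
    and U: "ultrafilter_on S U" "nonprincipal_on S U"
    unfolding measurable_cardinal_def by blast
  then have "countably_complete_on S U"
    by (intro measurable_cardinal_countably_complete)
  then obtain G :: "'g monoid" and h where "group G" "h \<in> epi (ultraproduct S (\<lambda>i. G) U) grigorchuk_group"
    using countable_group_image_of_ultrapower[OF assms group_grigorchuk_group countable_grigorchuk_group U(1)]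
    by blast
  with U show "\<exists>(I :: 'i set) (G :: 'i \<Rightarrow> 'g monoid) U h.
            (\<forall>i\<in>I. group (G i)) \<and> ultrafilter_on I U \<and> nonprincipal_on I U \<and>
            h \<in> epi (ultraproduct I G U) grigorchuk_group"
    by (intro exI[of _ S] exI[of _ "\<lambda>i. G"] exI[of _ U] exI[of _ h] conjI ballI)
qed

end
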